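(* Let $m\geq 1$, let $K$ be a simplicial complex on $[m]$, and let $(\underline{X},\underline{A})=\{(X_k,A_k)\}_{k=1}^m$ be a sequence of topological pairs. Put $A_k^c=X_k\setminus A_k$ and $(\underline{X},\underline{A}^c)=\{(X_k,A_k^c)\}_{k=1}^m$, and let $K^\circ$ be the dual of $K$ relative to $[m]$. Then the complement space of the polyhedral product space is $$(X_1\times\cdots\times X_m)\setminus \mathcal Z(K;\underline{X},\underline{A})=\mathcal Z(K^\circ;\underline{X},\underline{A}^c).$$
   Context: $[m]=\{1,\dots,m\}$. A simplicial complex on $[m]$ is a set of subsets of $[m]$ closed under taking subsets; ghost vertices ($\{i\}\notin K$) are allowed, and both $\{\emptyset\}$ and the void complex $\{\,\}$ (no simplices at all) are allowed. For a simplicial complex $K$ with vertex set a subset of a nonempty finite set $S$, the dual of $K$ relative to $S$ is $K^\circ=\{S\setminus\sigma \mid \sigma\subset S,\ \sigma\notin K\}$. A topological pair $(X,A)$ is a topological space $X$ with an arbitrary subspace $A$ (the empty space is allowed). For $\tau\subset[m]$ let $D(\tau)=Y_1\times\cdots\times Y_m$ with $Y_k=X_k$ if $k\in\tau$ and $Y_k=A_k$ if $k\notin\tau$. The polyhedral product space is the subspace $\mathcal Z(K;\underline X,\underline A)=\bigcup_{\tau\in K}D(\tau)$ of $X_1\times\cdots\times X_m$; in particular $\mathcal Z(\{\,\};\underline X,\underline A)=\emptyset$. *)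

theory Defs
  imports "HOL-Analysis.Analysis"
begin

text \<open>The empty set is not required to be a member: the empty family is the void complex. Members of
  \<open>S\<close> need not be vertices.\<close>

definition abstract_simplicial_complex :: "'v set \<Rightarrow> 'v set set \<Rightarrow> bool" where
  "abstract_simplicial_complex S K \<longleftrightarrow> (\<forall>\<sigma>\<in>K. \<sigma> \<subseteq> S \<and> (\<forall>\<tau>. \<tau> \<subseteq> \<sigma> \<longrightarrow> \<tau> \<in> K))"

definition dual_complex :: "'v set \<Rightarrow> 'v set set \<Rightarrow> 'v set set" where
  "dual_complex S K = {S - \<sigma> | \<sigma>. \<sigma> \<subseteq> S \<and> \<sigma> \<notin> K}"

lemma abstract_simplicial_complex_dual_complex:
  assumes "abstract_simplicial_complex S K"
  shows "abstract_simplicial_complex S (dual_complex S K)"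
  unfolding abstract_simplicial_complex_def
proof (intro ballI conjI allI impI)
  fix \<rho> assume "\<rho> \<in> dual_complex S K"
  then obtain \<sigma> where \<sigma>: "\<rho> = S - \<sigma>" "\<sigma> \<subseteq> S" "\<sigma> \<notin> K"
    by (auto simp: dual_complex_def)
  then show "\<rho> \<subseteq> S" by auto
  fix \<tau> assume \<tau>: "\<tau> \<subseteq> \<rho>"
  have "S - \<tau> \<notin> K"
    using assms \<sigma> \<tau> unfolding abstract_simplicial_complex_def by (metis Diff_mono double_diff order_refl)
  moreover have "\<tau> = S - (S - \<tau>)" using \<sigma> \<tau> by auto
  ultimately show "\<tau> \<in> dual_complex S K"
    unfolding dual_complex_def by blast
qed

text \<open>The subspace of a topological pair is given by its underlying set; it carries the subspace
  topology.\<close>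

definition topological_pair :: "'a topology \<Rightarrow> 'a set \<Rightarrow> bool" where
  "topological_pair X A \<longleftrightarrow> A \<subseteq> topspace X"

definition polyhedral_cell ::
  "nat \<Rightarrow> (nat \<Rightarrow> 'a topology) \<Rightarrow> (nat \<Rightarrow> 'a set) \<Rightarrow> nat set \<Rightarrow> (nat \<Rightarrow> 'a) set" where
  "polyhedral_cell m X A \<tau> = (\<Pi>\<^sub>E k\<in>{1..m}. if k \<in> \<tau> then topspace (X k) else A k)"

definition polyhedral_product ::
  "nat \<Rightarrow> nat set set \<Rightarrow> (nat \<Rightarrow> 'a topology) \<Rightarrow> (nat \<Rightarrow> 'a set) \<Rightarrow> (nat \<Rightarrow> 'a) topology" where
  "polyhedral_product m K X A =
     subtopology (product_topology X {1..m}) (\<Union>\<tau>\<in>K. polyhedral_cell m X A \<tau>)"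

end

theory Submission
  imports Defs
begin

text \<open>
  A point \<open>x\<close> of \<open>X\<^sub>1 \<times> \<dots> \<times> X\<^sub>m\<close> lies in the cell of \<open>\<tau>\<close> exactly when \<open>\<tau>\<close> contains
  \<open>\<sigma>(x) = {k. x\<^sub>k \<notin> A\<^sub>k}\<close>. As \<open>K\<close> is closed under subsets, \<open>x\<close> lies in the polyhedral product if and
  only if \<open>\<sigma>(x) \<in> K\<close> (lemma \<open>mem_Union_polyhedral_cell_iff\<close>). Replacing each \<open>A\<^sub>k\<close> by its complement
  replaces \<open>\<sigma>(x)\<close> by \<open>[m] - \<sigma>(x)\<close>, and \<open>[m] - \<sigma>(x)\<close> is a simplex of the dual complex if and only if
  \<open>\<sigma>(x) \<notin> K\<close> (lemma \<open>Diff_mem_dual_complex_iff\<close>). So both sides have the same points, and both carry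
  the subspace topology of the product.
\<close>

lemma Diff_mem_dual_complex_iff:
  assumes "\<sigma> \<subseteq> S"
  shows "S - \<sigma> \<in> dual_complex S K \<longleftrightarrow> \<sigma> \<notin> K"
proof
  assume "S - \<sigma> \<in> dual_complex S K"
  then obtain \<rho> where "S - \<sigma> = S - \<rho>" "\<rho> \<subseteq> S" "\<rho> \<notin> K"
    by (auto simp: dual_complex_def)
  with assms show "\<sigma> \<notin> K"
    by (metis double_diff order_refl)
next
  assume "\<sigma> \<notin> K"
  with assms show "S - \<sigma> \<in> dual_complex S K"
    by (auto simp: dual_complex_def)
qed

lemma mem_polyhedral_cell_iff:
  assumes "\<forall>k\<in>{1..m}. topological_pair (X k) (A k)"
  shows "x \<in> polyhedral_cell m X A \<tau> \<longleftrightarrow>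
    x \<in> topspace (product_topology X {1..m}) \<and> {k \<in> {1..m}. x k \<notin> A k} \<subseteq> \<tau>"
proof -
  have "x k \<in> (if k \<in> \<tau> then topspace (X k) else A k) \<longleftrightarrow>
      x k \<in> topspace (X k) \<and> (x k \<notin> A k \<longrightarrow> k \<in> \<tau>)" if "k \<in> {1..m}" for k
    using assms that by (auto simp: topological_pair_def)
  then have "(\<forall>k\<in>{1..m}. x k \<in> (if k \<in> \<tau> then topspace (X k) else A k)) \<longleftrightarrow>
      (\<forall>k\<in>{1..m}. x k \<in> topspace (X k)) \<and> {k \<in> {1..m}. x k \<notin> A k} \<subseteq> \<tau>"
    by blast
  then show ?thesis
    unfolding polyhedral_cell_def topspace_product_topology PiE_iff by blast
qed

lemma mem_Union_polyhedral_cell_iff: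
  assumes "abstract_simplicial_complex {1..m} K"
    and "\<forall>k\<in>{1..m}. topological_pair (X k) (A k)"
  shows "x \<in> (\<Union>\<tau>\<in>K. polyhedral_cell m X A \<tau>) \<longleftrightarrow>
    x \<in> topspace (product_topology X {1..m}) \<and> {k \<in> {1..m}. x k \<notin> A k} \<in> K"
proof -
  have "(\<exists>\<tau>\<in>K. {k \<in> {1..m}. x k \<notin> A k} \<subseteq> \<tau>) \<longleftrightarrow> {k \<in> {1..m}. x k \<notin> A k} \<in> K"
    using assms(1) unfolding abstract_simplicial_complex_def by blast
  then show ?thesis
    unfolding UN_iff mem_polyhedral_cell_iff[OF assms(2)] by blast
qed

theorem theorem2p4:
  fixes m :: nat and K :: "nat set set"
    and X :: "nat \<Rightarrow> 'a topology" and A :: "nat \<Rightarrow> 'a set"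
  assumes "m \<ge> 1"
    and "abstract_simplicial_complex {1..m} K"
    and "\<And>k. k \<in> {1..m} \<Longrightarrow> topological_pair (X k) (A k)"
  shows "subtopology (product_topology X {1..m})
           (topspace (product_topology X {1..m}) - topspace (polyhedral_product m K X A))
         = polyhedral_product m (dual_complex {1..m} K) X (\<lambda>k. topspace (X k) - A k)"
proof -
  let ?P = "topspace (product_topology X {1..m})"
  let ?Ac = "\<lambda>k. topspace (X k) - A k"
  have pair_Ac: "\<forall>k\<in>{1..m}. topological_pair (X k) (?Ac k)"
    by (auto simp: topological_pair_def)
  have pair_A: "\<forall>k\<in>{1..m}. topological_pair (X k) (A k)"
    using assms(3) by blast
  note mem_K = mem_Union_polyhedral_cell_iff[OF assms(2) pair_A]
  note mem_dual = mem_Union_polyhedral_cell_iff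
    [OF abstract_simplicial_complex_dual_complex[OF assms(2)] pair_Ac]
  have "?P - topspace (polyhedral_product m K X A)
      = (\<Union>\<tau>\<in>dual_complex {1..m} K. polyhedral_cell m X ?Ac \<tau>)"
  proof (rule set_eqI)
    fix x
    let ?\<sigma> = "{k \<in> {1..m}. x k \<notin> A k}"
    have compl: "{k \<in> {1..m}. x k \<notin> ?Ac k} = {1..m} - ?\<sigma>" if "x \<in> ?P"
      using that by (auto simp: PiE_iff)
    have "x \<in> ?P - topspace (polyhedral_product m K X A) \<longleftrightarrow> x \<in> ?P \<and> ?\<sigma> \<notin> K"
      unfolding polyhedral_product_def topspace_subtopology Diff_iff Int_iff mem_K by blast
    also have "\<dots> \<longleftrightarrow> x \<in> ?P \<and> {1..m} - ?\<sigma> \<in> dual_complex {1..m} K"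
      by (subst Diff_mem_dual_complex_iff) auto
    also have "\<dots> \<longleftrightarrow> x \<in> ?P \<and> {k \<in> {1..m}. x k \<notin> ?Ac k} \<in> dual_complex {1..m} K"
      by (rule conj_cong[OF refl]) (simp only: compl)
    also have "\<dots> \<longleftrightarrow> x \<in> (\<Union>\<tau>\<in>dual_complex {1..m} K. polyhedral_cell m X ?Ac \<tau>)"
      by (simp only: mem_dual)
    finally show "x \<in> ?P - topspace (polyhedral_product m K X A) \<longleftrightarrow>
      x \<in> (\<Union>\<tau>\<in>dual_complex {1..m} K. polyhedral_cell m X ?Ac \<tau>)" .
  qed
  then show ?thesis
    unfolding polyhedral_product_def by simp
qed

end
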